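(* Let $(Z_k)_{k\ge 1}$ be a fixed sequence of points in $\mathbb{R}^d$, let $\varepsilon>0$ be such that the balls $B(Z_k,\varepsilon)$, $k\ge1$, are pairwise disjoint, and let $(\alpha(j))_{j\ge1}$ be a sequence of positive integers. Write $\alpha_j=\alpha(j)$ and put $Z_{\alpha_0}:=0$. Let the random curve $\gamma=\{\gamma(r),\,r\in[0,1]\}$ be the trajectory of a standard Brownian motion in $\mathbb{R}^d$ (started at $0$). Then $$\lim_{n\to+\infty}\, n^{-2}\ln P\{\gamma \text{ has at least type } \alpha(1),\dots,\alpha(n) \text{ up to } \varepsilon\}\ \ge\ -\frac{\|Z_{\alpha_{j_*}}-Z_{\alpha_{j_*-1}}\|^{2}}{2},$$ where $Z_{\alpha_{j_*}}-Z_{\alpha_{j_*-1}}$ is selected from the set $\{Z_{\alpha_j}-Z_{\alpha_{j-1}}\}_{j\ge1}$ so that $\max_{j}\|Z_{\alpha_j}-Z_{\alpha_{j-1}}\|=\|Z_{\alpha_{j_*}}-Z_{\alpha_{j_*-1}}\|$.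
   Context: $\|\cdot\|$ is the Euclidean norm and $B(z,r)$ is the (closed) ball of radius $r$ centred at $z$ in $\mathbb{R}^d$. For points $u_1,\dots,u_n\in\mathbb{R}^d$, $\Gamma(u_1,\dots,u_n)$ denotes the polygonal line connecting $u_1,\dots,u_n$ in this order. A polygonal line $\Gamma(u_1,\dots,u_n)$ is inscribed up to $\varepsilon>0$ in a curve $\gamma$ parametrized by a continuous function $\xi:[0,1]\to\mathbb{R}^d$ if there exist $0\le t_1<\dots<t_n\le 1$ with $\xi(t_k)\in B(u_k,\varepsilon)$ for $k=1,\dots,n$. Given points $(Z_k)$ and $\varepsilon>0$ with the balls $B(Z_k,\varepsilon)$ pairwise disjoint, a polygonal line $\Gamma(u_1,\dots,u_n)$ has type $\alpha(1),\dots,\alpha(n)$ up to $\varepsilon$ if $u_j\in B(Z_{\alpha(j)},\varepsilon)$ for all $j=1,\dots,n$. The curve $\gamma$ has at least type $\alpha(1),\dots,\alpha(n)$ up to $\varepsilon$ if some polygonal line having type $\alpha(1),\dots,\alpha(n)$ up to $\varepsilon$ is inscribed in $\gamma$ up to $\varepsilon$.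
   Formalization: The limit is replaced by the lower limit (liminf), because the limit need not exist, e.g. when α alternates very long constant blocks with very long blocks switching between two far points; when the limit exists, the stated inequality follows. *)

theory Defs
  imports "HOL-Probability.Probability"
begin

text \<open>
  A Brownian motion with time set \<open>T\<close>. The density in the increment clause is that of the
  centred Gaussian law on the Euclidean space with covariance \<open>(t - s)\<close> times the identity: a
  product of one-dimensional normal densities over the orthonormal basis. All paths (not merely
  almost all) are continuous on \<open>T\<close>, so that the path events below are measurable without
  completing the probability space.
\<close>

definition standard_brownian_motion_on ::
  "'w measure \<Rightarrow> real set \<Rightarrow> (real \<Rightarrow> 'w \<Rightarrow> 'a::euclidean_space) \<Rightarrow> bool" where
  "standard_brownian_motion_on M T W \<longleftrightarrow>
     prob_space M \<and>
     (\<forall>t\<in>T. W t \<in> borel_measurable M) \<and>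
     (AE \<omega> in M. W 0 \<omega> = 0) \<and>
     (\<forall>s\<in>T. \<forall>t\<in>T. s < t \<longrightarrow>
        distributed M lborel (\<lambda>\<omega>. W t \<omega> - W s \<omega>)
          (\<lambda>x. ennreal (\<Prod>b\<in>Basis. normal_density 0 (sqrt (t - s)) (x \<bullet> b)))) \<and>
     (\<forall>m. \<forall>t::nat \<Rightarrow> real. t ` {..m} \<subseteq> T \<and> strict_mono_on {..m} t \<longrightarrow>
        prob_space.indep_vars M (\<lambda>_. borel) (\<lambda>i \<omega>. W (t (Suc i)) \<omega> - W (t i) \<omega>) {..<m}) \<and>
     (\<forall>\<omega>\<in>space M. continuous_on T (\<lambda>t. W t \<omega>))"

text \<open>
  A polygonal line \<open>\<Gamma>(u\<^sub>1, \<dots>, u\<^sub>n)\<close> is given by its ordered vertices, i.e. by \<open>n\<close> and the values of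
  \<open>u\<close> on \<open>{1..n}\<close>; a curve is given by its parametrization \<open>\<xi>\<close> on \<open>[0,1]\<close>.
\<close>

definition inscribed_up_to ::
  "real \<Rightarrow> nat \<Rightarrow> (nat \<Rightarrow> 'a::euclidean_space) \<Rightarrow> (real \<Rightarrow> 'a) \<Rightarrow> bool" where
  "inscribed_up_to \<epsilon> n u \<xi> \<longleftrightarrow>
     (\<exists>t::nat \<Rightarrow> real. t ` {1..n} \<subseteq> {0..1} \<and> strict_mono_on {1..n} t \<and>
        (\<forall>k\<in>{1..n}. \<xi> (t k) \<in> cball (u k) \<epsilon>))"

definition has_type_up_to ::
  "(nat \<Rightarrow> 'a::euclidean_space) \<Rightarrow> real \<Rightarrow> (nat \<Rightarrow> nat) \<Rightarrow> nat \<Rightarrow> (nat \<Rightarrow> 'a) \<Rightarrow> bool" where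
  "has_type_up_to Z \<epsilon> \<alpha> n u \<longleftrightarrow> (\<forall>j\<in>{1..n}. u j \<in> cball (Z (\<alpha> j)) \<epsilon>)"

definition has_at_least_type_up_to ::
  "(nat \<Rightarrow> 'a::euclidean_space) \<Rightarrow> real \<Rightarrow> (nat \<Rightarrow> nat) \<Rightarrow> nat \<Rightarrow> (real \<Rightarrow> 'a) \<Rightarrow> bool" where
  "has_at_least_type_up_to Z \<epsilon> \<alpha> n \<xi> \<longleftrightarrow>
     (\<exists>u. has_type_up_to Z \<epsilon> \<alpha> n u \<and> inscribed_up_to \<epsilon> n u \<xi>)"

text \<open>The sequence \<open>j \<mapsto> Z\<^bsub>\<alpha>(j)\<^esub>\<close> for \<open>j \<ge> 1\<close>, extended by the convention that its term of index 0 is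
  the origin; the value \<open>\<alpha> 0\<close> is irrelevant.\<close>

definition visited_point ::
  "(nat \<Rightarrow> 'a::euclidean_space) \<Rightarrow> (nat \<Rightarrow> nat) \<Rightarrow> nat \<Rightarrow> 'a" where
  "visited_point Z \<alpha> j = (if j = 0 then 0 else Z (\<alpha> j))"

text \<open>The logarithm of a probability, with \<open>ln 0 = -\<infinity>\<close>; the library's real \<open>ln\<close> has \<open>ln 0 = 0\<close>.\<close>

definition ln_prob :: "real \<Rightarrow> ereal" where
  "ln_prob p = (if p \<le> 0 then -\<infinity> else ereal (ln p))"

end

theory Submission
  imports Defs "HOL-Real_Asymp.Real_Asymp"
begin

text \<open>
  Visit the points \<open>V\<^sub>k = Z\<^bsub>\<alpha>(k)\<^esub>\<close> at the times \<open>k / n\<close>. If every increment of the Brownian motion over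
  \<open>[(k - 1) / n, k / n]\<close> lies within \<open>\<epsilon> / n\<close> of \<open>V\<^sub>k - V\<^sub>k\<^sub>-\<^sub>1\<close>, the accumulated error stays below \<open>\<epsilon>\<close>.
  The increments are independent and Gaussian with variance \<open>1 / n\<close>, so each of these \<open>n\<close> events has
  probability at least \<open>exp (- n D\<^sup>2 / 2 - O(ln n))\<close>, where \<open>D\<close> is the largest of the distances
  between consecutive points; the product is \<open>exp (- n\<^sup>2 D\<^sup>2 / 2 - O(n ln n))\<close>. The event of the
  theorem has to be shown measurable first, as the measure of a non-measurable set is \<open>0\<close>.
\<close>

section \<open>Measurability of the visiting event\<close>

text \<open>Sequential compactness of the finite power of \<open>K\<close>, by extracting one
  coordinate at a time: the extraction \<open>q\<close> for the new coordinate keeps the limits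
  already obtained along \<open>r\<close>.\<close>

lemma finite_family_convergent_subseq:
  fixes s :: "nat \<Rightarrow> 'k \<Rightarrow> 'c::heine_borel"
  assumes "finite I" and "compact K" and "\<And>p k. k \<in> I \<Longrightarrow> s p k \<in> K"
  shows "\<exists>r l. strict_mono (r :: nat \<Rightarrow> nat) \<and> (\<forall>k\<in>I. l k \<in> K \<and> (\<lambda>p. s (r p) k) \<longlonglongrightarrow> l k)"
  using assms(1,3)
proof (induction I)
  case empty
  show ?case by (rule exI[of _ id]) (simp add: strict_mono_def)
next
  case (insert x I)
  then obtain r l where r: "strict_mono (r :: nat \<Rightarrow> nat)"
    and l: "\<forall>k\<in>I. l k \<in> K \<and> (\<lambda>p. s (r p) k) \<longlonglongrightarrow> l k"
    by auto
  have "\<forall>p. s (r p) x \<in> K" using insert by auto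
  then obtain y q where y: "y \<in> K" and q: "strict_mono (q :: nat \<Rightarrow> nat)"
    and lim: "((\<lambda>p. s (r p) x) \<circ> q) \<longlonglongrightarrow> y"
    using assms(2) unfolding compact_eq_seq_compact_metric seq_compact_def by metis
  have "\<forall>k\<in>insert x I. (l(x := y)) k \<in> K \<and> (\<lambda>p. s ((r \<circ> q) p) k) \<longlonglongrightarrow> (l(x := y)) k"
  proof
    fix k assume k: "k \<in> insert x I"
    show "(l(x := y)) k \<in> K \<and> (\<lambda>p. s ((r \<circ> q) p) k) \<longlonglongrightarrow> (l(x := y)) k"
    proof (cases "k = x")
      case True
      then show ?thesis using y lim by (simp add: o_def)
    next
      case False
      then show ?thesis
        using k l LIMSEQ_subseq_LIMSEQ[OF _ q, of "\<lambda>p. s (r p) k" "l k"] by (simp add: o_def)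
    qed
  qed
  moreover have "strict_mono (r \<circ> q)" using r q by (rule strict_mono_o)
  ultimately show ?case by blast
qed

lemma strict_mono_on_finite_gap:
  fixes t :: "nat \<Rightarrow> real"
  assumes "finite I" and "strict_mono_on I t"
  obtains \<delta> where "\<delta> > 0" and "\<And>i j. i \<in> I \<Longrightarrow> j \<in> I \<Longrightarrow> i < j \<Longrightarrow> t i + \<delta> \<le> t j"
proof -
  \<comment> \<open>The extra element 1 makes \<open>Min G\<close> meaningful and positive when
    \<open>I\<close> contains no pair \<open>i < j\<close>.\<close>
  define G where "G = insert 1 ((\<lambda>(i, j). t j - t i) ` {(i, j) \<in> I \<times> I. i < j})"
  have "finite {(i, j) \<in> I \<times> I. i < j}"
    by (rule finite_subset[of _ "I \<times> I"]) (use assms(1) in auto)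
  then have fin: "finite G" by (simp add: G_def)
  show thesis
  proof (rule that[of "Min G"])
    have "\<forall>x\<in>G. x > 0" using assms(2) by (auto simp: G_def strict_mono_on_def)
    then show "Min G > 0" using fin by (simp add: G_def)
    fix i j assume "i \<in> I" "j \<in> I" "i < j"
    then have "t j - t i \<in> G" by (force simp: G_def)
    then have "Min G \<le> t j - t i" using fin by simp
    then show "t i + Min G \<le> t j" by simp
  qed
qed

lemma rational_in_unit_interval_near:
  fixes x \<eta> :: real
  assumes "x \<in> {0..1}" and "\<eta> > 0"
  obtains q where "q \<in> \<rat> \<inter> {0..1}" and "\<bar>q - x\<bar> < \<eta>"
proof (cases "x = 1")
  \<comment> \<open>There is no room to the right of 1 within the interval, but 1 is itself
    rational.\<close>
  case True
  show thesis by (rule that[of 1]) (use True assms in auto)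
next
  case False
  then have "x < min 1 (x + \<eta>)" using assms by auto
  then obtain q where "q \<in> \<rat>" "x < q" "q < min 1 (x + \<eta>)" using Rats_dense_in_real by blast
  then show thesis using assms by (intro that[of q]) auto
qed

text \<open>Reduces a quantification over real times to countably many ones. The uniform gap
  \<open>1 / Suc m\<close> makes the set of admissible time vectors compact, so strictness survives the limit.\<close>

lemma ex_strict_mono_nonpos_iff_rational:
  fixes g :: "nat \<Rightarrow> real \<Rightarrow> real"
  assumes fin: "finite I" and cont: "\<And>k. k \<in> I \<Longrightarrow> continuous_on {0..1} (g k)"
  shows "(\<exists>t. t ` I \<subseteq> {0..1} \<and> strict_mono_on I t \<and> (\<forall>k\<in>I. g k (t k) \<le> 0)) \<longleftrightarrow>
    (\<exists>m::nat. \<forall>p::nat. \<exists>q\<in>Pi\<^sub>E I (\<lambda>_. \<rat> \<inter> {0..1}).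
      (\<forall>i\<in>I. \<forall>j\<in>I. i < j \<longrightarrow> q i + 1 / real (Suc m) \<le> q j) \<and>
      (\<forall>k\<in>I. g k (q k) \<le> 1 / real (Suc p)))" (is "?L \<longleftrightarrow> ?R")
proof
  assume ?L
  then obtain t where t: "t ` I \<subseteq> {0..1}" "strict_mono_on I t" "\<forall>k\<in>I. g k (t k) \<le> 0" by blast
  obtain \<delta> where \<delta>: "\<delta> > 0" and gap: "\<And>i j. i \<in> I \<Longrightarrow> j \<in> I \<Longrightarrow> i < j \<Longrightarrow> t i + \<delta> \<le> t j"
    using strict_mono_on_finite_gap[OF fin t(2)] by blast
  \<comment> \<open>The rational times will differ from the \<open>t k\<close> by less than
    \<open>\<delta> / 4\<close> each, so a gap of at least \<open>\<delta> / 2\<close> is left. This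
    \<open>m\<close> has to be fixed before \<open>p\<close>, uniformly in the tolerance.\<close>
  obtain m :: nat where m: "1 / real (Suc m) < \<delta> / 2"
    using nat_approx_posE[of "\<delta> / 2"] \<delta> by auto
  have "\<exists>q\<in>Pi\<^sub>E I (\<lambda>_. \<rat> \<inter> {0..1}). (\<forall>i\<in>I. \<forall>j\<in>I. i < j \<longrightarrow> q i + 1 / real (Suc m) \<le> q j) \<and>
      (\<forall>k\<in>I. g k (q k) \<le> 1 / real (Suc p))" for p :: nat
  proof -
    \<comment> \<open>Continuity of \<open>g k\<close> at \<open>t k\<close> absorbs the move to a
      rational time within the tolerance \<open>1 / Suc p\<close>; this is why the rational side
      cannot ask for a value at most 0.\<close>
    have "\<exists>x. x \<in> \<rat> \<inter> {0..1} \<and> \<bar>x - t k\<bar> < \<delta> / 4 \<and> g k x \<le> 1 / real (Suc p)" if k: "k \<in> I" for k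
    proof -
      have tk: "t k \<in> {0..1}" using t k by auto
      have "1 / real (Suc p) > 0" by simp
      then obtain \<eta> where \<eta>: "\<eta> > 0"
        "\<And>x. x \<in> {0..1} \<Longrightarrow> dist x (t k) < \<eta> \<Longrightarrow> dist (g k x) (g k (t k)) < 1 / real (Suc p)"
        using cont[OF k] tk unfolding continuous_on_iff by meson
      obtain x where x: "x \<in> \<rat> \<inter> {0..1}" "\<bar>x - t k\<bar> < min \<eta> (\<delta> / 4)"
        using rational_in_unit_interval_near[OF tk, of "min \<eta> (\<delta> / 4)"] \<eta>(1) \<delta> by auto
      have "dist (g k x) (g k (t k)) < 1 / real (Suc p)" using x \<eta>(2)[of x] by (auto simp: dist_real_def)
      moreover have "g k (t k) \<le> 0" using t k by auto
      ultimately have "g k x \<le> 1 / real (Suc p)" unfolding dist_real_def by linarith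
      then show ?thesis using x by auto
    qed
    then obtain q where q: "\<And>k. k \<in> I \<Longrightarrow> q k \<in> \<rat> \<inter> {0..1} \<and> \<bar>q k - t k\<bar> < \<delta> / 4 \<and> g k (q k) \<le> 1 / real (Suc p)"
      by metis
    have "q i + 1 / real (Suc m) \<le> q j" if "i \<in> I" "j \<in> I" "i < j" for i j
    proof -
      have "\<bar>q i - t i\<bar> < \<delta> / 4" "\<bar>q j - t j\<bar> < \<delta> / 4" using q that by auto
      then show ?thesis using gap[OF that] m by linarith
    qed
    \<comment> \<open>Restricting to \<open>I\<close> gives an extensional function, as membership
      in \<open>Pi\<^sub>E\<close> demands.\<close>
    then show ?thesis using q by (intro bexI[of _ "restrict q I"]) auto
  qed
  then show ?R by blast
next
  assume ?R
  \<comment> \<open>One time vector \<open>s p\<close> is chosen for each tolerance; the limit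
    \<open>l\<close> of a convergent subsequence is the required real time vector, the tolerances
    tending to 0.\<close>
  then obtain m :: nat and s where s: "\<And>p. s p \<in> Pi\<^sub>E I (\<lambda>_. \<rat> \<inter> {0..1::real})"
    and gap: "\<And>p i j. i \<in> I \<Longrightarrow> j \<in> I \<Longrightarrow> i < j \<Longrightarrow> s p i + 1 / real (Suc m) \<le> s p j"
    and le: "\<And>p k. k \<in> I \<Longrightarrow> g k (s p k) \<le> 1 / real (Suc p)"
    by metis
  have s01: "s p k \<in> {0..1}" if "k \<in> I" for p k using s[of p] that by auto
  then obtain r l where r: "strict_mono (r :: nat \<Rightarrow> nat)"
    and l: "\<And>k. k \<in> I \<Longrightarrow> l k \<in> {0..1}" "\<And>k. k \<in> I \<Longrightarrow> (\<lambda>p. s (r p) k) \<longlonglongrightarrow> l k"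
    using finite_family_convergent_subseq[OF fin compact_Icc[of 0 "1::real"], of s] by blast
  have "l i < l j" if "i \<in> I" "j \<in> I" "i < j" for i j
  proof -
    have "l i + 1 / real (Suc m) \<le> l j"
      using gap[OF that] by (intro LIMSEQ_le[OF tendsto_add[OF l(2) tendsto_const] l(2)] that) auto
    moreover have "1 / real (Suc m) > 0" by simp
    ultimately show ?thesis by linarith
  qed
  moreover have "g k (l k) \<le> 0" if k: "k \<in> I" for k
  proof (rule LIMSEQ_le)
    show "(\<lambda>p. g k (s (r p) k)) \<longlonglongrightarrow> g k (l k)"
      using cont[OF k] l(1)[OF k] l(2)[OF k] s01[OF k] unfolding continuous_on_sequentially o_def by simp
    show "(\<lambda>p. 1 / real (Suc (r p))) \<longlonglongrightarrow> 0"
      using LIMSEQ_subseq_LIMSEQ[OF LIMSEQ_inverse_real_of_nat r] by (simp add: o_def inverse_eq_divide)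
    show "\<exists>N. \<forall>p\<ge>N. g k (s (r p) k) \<le> 1 / real (Suc (r p))" using le[OF k] by blast
  qed
  ultimately show ?L using l(1) by (intro exI[of _ l]) (auto simp: strict_mono_on_def)
qed

text \<open>By the equivalence above, the event arises by countable unions and intersections from
  conditions on \<open>f\<close> at finitely many fixed times.\<close>

lemma sets_Collect_ex_strict_mono_nonpos:
  fixes f :: "nat \<Rightarrow> real \<Rightarrow> 'w \<Rightarrow> real"
  assumes fin: "finite I"
    and meas: "\<And>k t. k \<in> I \<Longrightarrow> t \<in> {0..1} \<Longrightarrow> f k t \<in> borel_measurable M"
    and cont: "\<And>k \<omega>. k \<in> I \<Longrightarrow> \<omega> \<in> space M \<Longrightarrow> continuous_on {0..1} (\<lambda>t. f k t \<omega>)"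
  shows "{\<omega> \<in> space M. \<exists>t. t ` I \<subseteq> {0..1} \<and> strict_mono_on I t \<and> (\<forall>k\<in>I. f k (t k) \<omega> \<le> 0)} \<in> sets M"
proof -
  let ?Q = "Pi\<^sub>E I (\<lambda>_. \<rat> \<inter> {0..1::real})"
  let ?P = "\<lambda>m p q \<omega>. (\<forall>i\<in>I. \<forall>j\<in>I. i < j \<longrightarrow> q i + 1 / real (Suc m) \<le> q j) \<and>
      (\<forall>k\<in>I. f k (q k) \<omega> \<le> 1 / real (Suc p))"
  \<comment> \<open>Extensionality matters here: the values outside the finite set \<open>I\<close>
    are fixed, so only finitely many rational coordinates are free.\<close>
  have "countable ?Q"
    by (rule countable_PiE[OF fin]) (simp add: countable_rat countable_Int1)
  moreover have "{\<omega> \<in> space M. ?P m p q \<omega>} \<in> sets M" if "q \<in> ?Q" for m p :: nat and q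
  proof -
    have "{\<omega> \<in> space M. f k (q k) \<omega> \<le> 1 / real (Suc p)} \<in> sets M" if "k \<in> I" for k
    proof -
      have "f k (q k) \<in> borel_measurable M" using meas[OF that] PiE_mem[OF \<open>q \<in> ?Q\<close> that] by blast
      then show ?thesis by measurable
    qed
    then have "{\<omega> \<in> space M. \<forall>k\<in>I. f k (q k) \<omega> \<le> 1 / real (Suc p)} \<in> sets M"
      using fin by (rule sets.sets_Collect_finite_All)
    then show ?thesis by (intro sets.sets_Collect_conj sets.sets_Collect_const)
  qed
  ultimately have "{\<omega> \<in> space M. \<exists>q\<in>?Q. ?P m p q \<omega>} \<in> sets M" for m p :: nat
    by (intro sets.sets_Collect_countable_Ex')
  then have "{\<omega> \<in> space M. \<exists>m::nat. \<forall>p::nat. \<exists>q\<in>?Q. ?P m p q \<omega>} \<in> sets M"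
    by (rule sets.sets_Collect_countable_Ex[OF sets.sets_Collect_countable_All])
  also have "{\<omega> \<in> space M. \<exists>m::nat. \<forall>p::nat. \<exists>q\<in>?Q. ?P m p q \<omega>} =
    {\<omega> \<in> space M. \<exists>t. t ` I \<subseteq> {0..1} \<and> strict_mono_on I t \<and> (\<forall>k\<in>I. f k (t k) \<omega> \<le> 0)}"
  proof (intro Collect_cong conj_cong refl)
    fix \<omega> assume "\<omega> \<in> space M"
    then show "(\<exists>m::nat. \<forall>p::nat. \<exists>q\<in>?Q. ?P m p q \<omega>) =
      (\<exists>t. t ` I \<subseteq> {0..1} \<and> strict_mono_on I t \<and> (\<forall>k\<in>I. f k (t k) \<omega> \<le> 0))"
      by (intro ex_strict_mono_nonpos_iff_rational[OF fin, symmetric] cont)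
  qed
  finally show ?thesis .
qed

text \<open>Eliminates the uncountable choice of the vertices \<open>u\<close>: the triangle
  inequality bounds the distance by \<open>2 * \<epsilon>\<close>, and conversely the midpoint
  serves as vertex. The form \<open>\<le> 0\<close> fits the measurability lemma.\<close>

lemma has_at_least_type_up_to_iff:
  assumes "\<epsilon> \<ge> 0"
  shows "has_at_least_type_up_to Z \<epsilon> \<alpha> n \<xi> \<longleftrightarrow>
    (\<exists>t. t ` {1..n} \<subseteq> {0..1} \<and> strict_mono_on {1..n} t \<and>
      (\<forall>k\<in>{1..n}. dist (\<xi> (t k)) (Z (\<alpha> k)) - 2 * \<epsilon> \<le> 0))" (is "?L \<longleftrightarrow> ?R")
proof
  assume ?L
  then obtain u t where u: "\<forall>j\<in>{1..n}. u j \<in> cball (Z (\<alpha> j)) \<epsilon>"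
    and t: "t ` {1..n} \<subseteq> {0..1}" "strict_mono_on {1..n} t" "\<forall>k\<in>{1..n}. \<xi> (t k) \<in> cball (u k) \<epsilon>"
    unfolding has_at_least_type_up_to_def has_type_up_to_def inscribed_up_to_def by blast
  have "dist (\<xi> (t k)) (Z (\<alpha> k)) - 2 * \<epsilon> \<le> 0" if "k \<in> {1..n}" for k
  proof -
    have "dist (Z (\<alpha> k)) (u k) \<le> \<epsilon>" "dist (u k) (\<xi> (t k)) \<le> \<epsilon>" using u t(3) that by auto
    then show ?thesis using dist_triangle[of "\<xi> (t k)" "Z (\<alpha> k)" "u k"] by (simp add: dist_commute)
  qed
  then show ?R using t by blast
next
  assume ?R
  then obtain t where t: "t ` {1..n} \<subseteq> {0..1}" "strict_mono_on {1..n} t"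
    "\<And>k. k \<in> {1..n} \<Longrightarrow> dist (\<xi> (t k)) (Z (\<alpha> k)) \<le> 2 * \<epsilon>" by fastforce
  define u where "u k = midpoint (\<xi> (t k)) (Z (\<alpha> k))" for k
  have "u k \<in> cball (Z (\<alpha> k)) \<epsilon> \<and> \<xi> (t k) \<in> cball (u k) \<epsilon>" if "k \<in> {1..n}" for k
    using t(3)[OF that] dist_midpoint(1,4)[of "\<xi> (t k)" "Z (\<alpha> k)"] by (simp add: u_def dist_commute dist_midpoint)
  then show ?L
    unfolding has_at_least_type_up_to_def has_type_up_to_def inscribed_up_to_def using t(1,2) by blast
qed

section \<open>Gaussian lower bound for one increment\<close>

lemma prod_normal_density_Basis:
  fixes x :: "'a::euclidean_space"
  shows "(\<Prod>b\<in>Basis. normal_density 0 \<sigma> (x \<bullet> b)) =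
    (1 / sqrt (2 * pi * \<sigma>\<^sup>2)) ^ DIM('a) * exp (- (norm x)\<^sup>2 / (2 * \<sigma>\<^sup>2))"
proof -
  have "(norm x)\<^sup>2 = (\<Sum>b\<in>Basis. (x \<bullet> b)\<^sup>2)"
    unfolding power2_norm_eq_inner by (subst euclidean_inner) (simp add: power2_eq_square)
  then show ?thesis
    unfolding normal_density_def prod.distrib
    by (simp add: exp_sum[symmetric] sum_divide_distrib[symmetric] sum_negf)
qed

text \<open>The density is a decreasing function of the norm, and points of the ball have norm at
  most \<open>D + r\<close>. Hence the probability is at least the volume of the ball times the
  density at norm \<open>D + r\<close>.\<close>

lemma (in prob_space) prob_gaussian_cball_ge:
  fixes X :: "'a \<Rightarrow> 'b::euclidean_space"
  assumes X: "distributed M lborel X (\<lambda>x. ennreal (\<Prod>b\<in>Basis. normal_density 0 \<sigma> (x \<bullet> b)))"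
    and \<sigma>: "\<sigma> > 0" and r: "r \<ge> 0" and c: "norm c \<le> D"
  shows "unit_ball_vol DIM('b) * r ^ DIM('b) *
      ((1 / sqrt (2 * pi * \<sigma>\<^sup>2)) ^ DIM('b) * exp (- (D + r)\<^sup>2 / (2 * \<sigma>\<^sup>2)))
    \<le> prob (X -` cball c r \<inter> space M)" (is "?V * ?m \<le> _")
proof -
  have m0: "?m \<ge> 0" by simp
  have V0: "?V \<ge> 0" using r by simp
  have "ennreal ?m * indicator (cball c r) x \<le>
     ennreal (\<Prod>b\<in>Basis. normal_density 0 \<sigma> (x \<bullet> b)) * indicator (cball c r) x" for x
  proof (cases "x \<in> cball c r")
    case True
    have "norm x \<le> D + r"
      using True c norm_triangle_ineq[of c "x - c"] by (simp add: dist_norm norm_minus_commute)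
    then have "(norm x)\<^sup>2 \<le> (D + r)\<^sup>2" by (intro power_mono) auto
    then have "- (D + r)\<^sup>2 / (2 * \<sigma>\<^sup>2) \<le> - (norm x)\<^sup>2 / (2 * \<sigma>\<^sup>2)"
      using \<sigma> by (intro divide_right_mono) auto
    then have "?m \<le> (\<Prod>b\<in>Basis. normal_density 0 \<sigma> (x \<bullet> b))"
      unfolding prod_normal_density_Basis by (intro mult_left_mono) auto
    then show ?thesis using True by (simp add: ennreal_leI)
  qed simp
  then have "(\<integral>\<^sup>+x. ennreal ?m * indicator (cball c r) x \<partial>lborel) \<le>
     (\<integral>\<^sup>+x. ennreal (\<Prod>b\<in>Basis. normal_density 0 \<sigma> (x \<bullet> b)) * indicator (cball c r) x \<partial>lborel)"
    by (intro nn_integral_mono) auto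
  also have "\<dots> = emeasure M (X -` cball c r \<inter> space M)"
    using distributed_emeasure[OF X] by simp
  also have "(\<integral>\<^sup>+x. ennreal ?m * indicator (cball c r) x \<partial>lborel) = ennreal (?V * ?m)"
    unfolding ennreal_mult[OF V0 m0] mult.commute[of "ennreal ?V"]
    by (subst nn_integral_cmult) (simp_all add: emeasure_cball[OF r] borel_measurable_indicator del: ennreal_mult'' ennreal_mult')
  finally show ?thesis
    by (simp add: emeasure_eq_measure)
qed

text \<open>Telescoping: the errors of the single steps at most add up.\<close>

lemma norm_diff_le_sum_increments:
  fixes x v :: "nat \<Rightarrow> 'a::real_normed_vector"
  assumes "x 0 = v 0" and "\<And>i. i < k \<Longrightarrow> norm ((x (Suc i) - x i) - (v (Suc i) - v i)) \<le> r"
  shows "norm (x k - v k) \<le> real k * r"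
proof -
  have "x k - v k = (\<Sum>i<k. (x (Suc i) - x i) - (v (Suc i) - v i))"
    using sum_lessThan_telescope[of "\<lambda>i. x i - v i" k] assms(1) by (simp add: algebra_simps)
  also have "norm \<dots> \<le> (\<Sum>i<k. r)" using assms(2) by (intro sum_norm_le) auto
  finally show ?thesis by simp
qed

text \<open>The volume of a ball of radius \<open>\<epsilon> / n\<close> times the value at norm \<open>D + \<epsilon> / n\<close> of the Gaussian density
  with variance \<open>1 / n\<close>.\<close>

definition step_bound :: "nat \<Rightarrow> real \<Rightarrow> real \<Rightarrow> nat \<Rightarrow> real" where
  "step_bound d \<epsilon> D n = unit_ball_vol d * (\<epsilon> / n) ^ d *
     ((1 / sqrt (2 * pi * (1 / n))) ^ d * exp (- (D + \<epsilon> / n)\<^sup>2 / (2 * (1 / n))))"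

section \<open>Asymptotics of the one-step bound\<close>

lemma step_bound_pos:
  assumes "\<epsilon> > 0" and "n > 0"
  shows "step_bound d \<epsilon> D n > 0"
  using assms by (simp add: step_bound_def)

lemma ln_step_bound:
  assumes "\<epsilon> > 0" and "n > 0"
  shows "ln (step_bound d \<epsilon> D n) = ln (unit_ball_vol d) + d * (ln \<epsilon> - ln n) -
    d * (ln (2 * pi) - ln n) / 2 - (D + \<epsilon> / n)\<^sup>2 * n / 2"
proof -
  have "ln (1 / sqrt (2 * pi * (1 / n))) = - ln (2 * pi / n) / 2"
    using assms by (subst ln_div) (simp_all add: ln_sqrt)
  also have "ln (2 * pi / n) = ln (2 * pi) - ln n"
    using assms by (subst ln_div) simp_all
  finally have s: "ln (1 / sqrt (2 * pi * (1 / n))) = - (ln (2 * pi) - ln n) / 2" .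
  have pos: "unit_ball_vol d > 0" "(\<epsilon> / n) ^ d > 0" "(1 / sqrt (2 * pi * (1 / n))) ^ d > 0"
    using assms by simp_all
  have "ln (\<epsilon> / n) = ln \<epsilon> - ln n"
    using assms by (subst ln_div) simp_all
  then have "ln ((\<epsilon> / n) ^ d) = d * (ln \<epsilon> - ln n)"
    "ln ((1 / sqrt (2 * pi * (1 / n))) ^ d) = - (d * (ln (2 * pi) - ln n) / 2)"
    using assms s by (simp_all only: ln_realpow)
  then show ?thesis
    unfolding step_bound_def
    by (simp only: ln_mult_pos[OF mult_pos_pos[OF pos(1,2)] mult_pos_pos[OF pos(3) exp_gt_zero]]
        ln_mult_pos[OF pos(1,2)] ln_mult_pos[OF pos(3) exp_gt_zero] ln_exp) simp
qed

text \<open>The logarithm of the one-step bound is \<open>- D\<^sup>2 * n / 2\<close> up to a term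
  of order \<open>ln n\<close>, which vanishes after division by \<open>n\<close>.\<close>

lemma ln_step_bound_limit:
  assumes "\<epsilon> > 0"
  shows "(\<lambda>n. 1 / (real n)\<^sup>2 * (real n * ln (step_bound d \<epsilon> D n))) \<longlonglongrightarrow> - (D\<^sup>2 / 2)"
proof -
  \<comment> \<open>\<open>a\<close> collects the terms constant in \<open>n\<close>, with
    \<open>D * \<epsilon>\<close> coming from the cross term of
    \<open>(D + \<epsilon> / n)\<^sup>2 * n / 2\<close>. \<open>b\<close> is the net coefficient of
    \<open>- ln n\<close>: the volume contributes \<open>d\<close>, the normalization of the density
    takes back \<open>d / 2\<close>.\<close>
  define a b where "a = ln (unit_ball_vol d) + d * ln \<epsilon> - d * ln (2 * pi) / 2 - D * \<epsilon>"
    and "b = real d / 2"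
  have "(\<lambda>n::nat. a * (1 / n) - b * (ln n / n) - D\<^sup>2 / 2 - \<epsilon>\<^sup>2 * (1 / (real n)\<^sup>2) / 2)
      \<longlonglongrightarrow> a * 0 - b * 0 - D\<^sup>2 / 2 - \<epsilon>\<^sup>2 * 0 / 2"
    by (intro tendsto_diff tendsto_mult tendsto_divide tendsto_const; (simp; fail)?; real_asymp)
  moreover have "\<forall>\<^sub>F n in sequentially. a * (1 / n) - b * (ln n / n) - D\<^sup>2 / 2 - \<epsilon>\<^sup>2 * (1 / (real n)\<^sup>2) / 2 =
      1 / (real n)\<^sup>2 * (real n * ln (step_bound d \<epsilon> D n))"
    using eventually_gt_at_top[of 0]
  proof eventually_elim
    case (elim n)
    show ?case unfolding ln_step_bound[OF assms elim] a_def b_def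
      using elim by (simp add: field_simps power2_eq_square)
  qed
  ultimately have "(\<lambda>n. 1 / (real n)\<^sup>2 * (real n * ln (step_bound d \<epsilon> D n)))
      \<longlonglongrightarrow> a * 0 - b * 0 - D\<^sup>2 / 2 - \<epsilon>\<^sup>2 * 0 / 2"
    by (rule Lim_transform_eventually)
  then show ?thesis by simp
qed

section \<open>Lower bound for the probability and its limit\<close>

lemma prob_at_least_type_ge:
  fixes \<gamma> :: "real \<Rightarrow> 'w \<Rightarrow> 'a::euclidean_space"
  assumes bm: "standard_brownian_motion_on M {0..1} \<gamma>"
    and \<epsilon>: "\<epsilon> > 0" and n: "n > 0"
    and D: "\<And>j. j \<ge> 1 \<Longrightarrow> norm (visited_point Z \<alpha> j - visited_point Z \<alpha> (j - 1)) \<le> D"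
  shows "step_bound DIM('a) \<epsilon> D n ^ n \<le>
    measure M {\<omega> \<in> space M. has_at_least_type_up_to Z \<epsilon> \<alpha> n (\<lambda>r. \<gamma> r \<omega>)}" (is "_ \<le> measure M ?E")
proof -
  interpret prob_space M using bm by (simp add: standard_brownian_motion_on_def)
  define \<tau> where "\<tau> k = real k / real n" for k
  \<comment> \<open>Indices are shifted: \<open>X k\<close> leads from the point of index
    \<open>k\<close> to that of index \<open>k + 1\<close>, for \<open>k < n\<close>, starting from
    \<open>V 0 = 0\<close>.\<close>
  define X where "X k \<omega> = \<gamma> (\<tau> (Suc k)) \<omega> - \<gamma> (\<tau> k) \<omega>" for k \<omega>
  define V where "V = visited_point Z \<alpha>"
  define B where "B k = cball (V (Suc k) - V k) (\<epsilon> / n)" for k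
  define A where "A = (\<Inter>k\<in>{..<n}. X k -` B k \<inter> space M)"
  have \<tau>01: "\<tau> k \<in> {0..1}" if "k \<le> n" for k using that n by (simp add: \<tau>_def)
  have \<tau>_less: "\<tau> i < \<tau> j" if "i < j" for i j using that n by (simp add: \<tau>_def divide_strict_right_mono)
  have "\<tau> ` {..n} \<subseteq> {0..1} \<and> strict_mono_on {..n} \<tau>"
    using \<tau>01 \<tau>_less by (auto simp: strict_mono_on_def)
  then have indep: "indep_vars (\<lambda>_. borel) X {..<n}"
    using bm unfolding standard_brownian_motion_on_def X_def[abs_def] by blast
  have meas: "\<gamma> t \<in> borel_measurable M" if "t \<in> {0..1}" for t
    using bm that by (simp add: standard_brownian_motion_on_def)
  have cont: "continuous_on {0..1} (\<lambda>t. \<gamma> t \<omega>)" if "\<omega> \<in> space M" for \<omega>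
    using bm that by (simp add: standard_brownian_motion_on_def)
  have "step_bound DIM('a) \<epsilon> D n \<le> prob (X k -` B k \<inter> space M)" if "k < n" for k
  proof -
    have \<tau>d: "\<tau> (Suc k) - \<tau> k = 1 / n" by (simp add: \<tau>_def add_divide_distrib)
    have "\<tau> k \<in> {0..1}" "\<tau> (Suc k) \<in> {0..1}" "\<tau> k < \<tau> (Suc k)" using \<tau>01 \<tau>_less that by auto
    then have "distributed M lborel (X k)
        (\<lambda>x. ennreal (\<Prod>b\<in>Basis. normal_density 0 (sqrt (\<tau> (Suc k) - \<tau> k)) (x \<bullet> b)))"
      using bm unfolding standard_brownian_motion_on_def X_def[abs_def] by blast
    then have "distributed M lborel (X k)
        (\<lambda>x. ennreal (\<Prod>b\<in>Basis. normal_density 0 (sqrt (1 / n)) (x \<bullet> b)))"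
      unfolding \<tau>d .
    moreover have "norm (V (Suc k) - V k) \<le> D" using D[of "Suc k"] by (simp add: V_def)
    ultimately show ?thesis
      using prob_gaussian_cball_ge[of "X k" "sqrt (1 / n)" "\<epsilon> / n" "V (Suc k) - V k" D] n \<epsilon>
      by (simp add: step_bound_def B_def)
  qed
  then have "(\<Prod>k<n. step_bound DIM('a) \<epsilon> D n) \<le> (\<Prod>k<n. prob (X k -` B k \<inter> space M))"
    using step_bound_pos[OF \<epsilon> n] by (intro prod_mono) (auto intro: less_imp_le)
  \<comment> \<open>Independence of the increments; \<open>n > 0\<close> makes the index set
    nonempty, without which \<open>A\<close> would be the whole type.\<close>
  also have "\<dots> = prob A"
    unfolding A_def using n by (intro indep_varsD_finite[OF indep, symmetric]) (auto simp: B_def)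
  also have "\<dots> \<le> prob ?E"
  proof (rule finite_measure_mono_AE)
    \<comment> \<open>The inclusion holds only almost everywhere, since paths start at 0 only almost
      surely.\<close>
    have "AE \<omega> in M. \<gamma> 0 \<omega> = 0" using bm by (simp add: standard_brownian_motion_on_def)
    then show "AE \<omega> in M. \<omega> \<in> A \<longrightarrow> \<omega> \<in> ?E"
    proof eventually_elim
      case (elim \<omega>)
      show ?case
      proof
        assume "\<omega> \<in> A"
        then have inc: "\<And>k. k < n \<Longrightarrow> X k \<omega> \<in> B k" and \<omega>: "\<omega> \<in> space M"
          using n unfolding A_def by blast+
        \<comment> \<open>After \<open>k \<le> n\<close> steps the accumulated error is at most
          \<open>k * (\<epsilon> / n) \<le> \<epsilon>\<close>, half of the admissible
          \<open>2 * \<epsilon>\<close>.\<close>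
        have "dist (\<gamma> (\<tau> k) \<omega>) (Z (\<alpha> k)) - 2 * \<epsilon> \<le> 0" if k: "k \<in> {1..n}" for k
        proof -
          have "norm (\<gamma> (\<tau> k) \<omega> - V k) \<le> real k * (\<epsilon> / n)"
          proof (rule norm_diff_le_sum_increments)
            show "\<gamma> (\<tau> 0) \<omega> = V 0" using elim by (simp add: \<tau>_def V_def visited_point_def)
            fix i assume "i < k"
            then show "norm (\<gamma> (\<tau> (Suc i)) \<omega> - \<gamma> (\<tau> i) \<omega> - (V (Suc i) - V i)) \<le> \<epsilon> / n"
              using inc[of i] k by (simp add: B_def X_def dist_norm norm_minus_commute)
          qed
          also have "\<dots> \<le> \<epsilon>" using k \<epsilon> n by (simp add: field_simps)
          finally show ?thesis using k \<epsilon> by (simp add: V_def visited_point_def dist_norm)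
        qed
        then have "has_at_least_type_up_to Z \<epsilon> \<alpha> n (\<lambda>r. \<gamma> r \<omega>)"
          unfolding has_at_least_type_up_to_iff[OF less_imp_le[OF \<epsilon>]]
          using \<tau>01 \<tau>_less by (intro exI[of _ \<tau>]) (auto simp: strict_mono_on_def)
        then show "\<omega> \<in> ?E" using \<omega> by simp
      qed
    qed
    show "?E \<in> sets M"
      unfolding has_at_least_type_up_to_iff[OF less_imp_le[OF \<epsilon>]]
      by (intro sets_Collect_ex_strict_mono_nonpos finite_atLeastAtMost borel_measurable_diff
          borel_measurable_dist borel_measurable_const meas continuous_on_diff continuous_on_dist
          continuous_on_const cont)
  qed
  finally show ?thesis by simp
qed

theorem theorem2p1:
  fixes M :: "'w measure"
    and \<gamma> :: "real \<Rightarrow> 'w \<Rightarrow> 'a::euclidean_space"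
    and Z :: "nat \<Rightarrow> 'a"
    and \<alpha> :: "nat \<Rightarrow> nat"
    and \<epsilon> :: real
    and jstar :: nat
  assumes "standard_brownian_motion_on M {0..1} \<gamma>"
    and "\<epsilon> > 0"
    and "disjoint_family_on (\<lambda>k. cball (Z k) \<epsilon>) {1..}"
    and "\<forall>j\<ge>1. \<alpha> j \<ge> 1"
    and "jstar \<ge> 1"
    and "\<forall>j\<ge>1. norm (visited_point Z \<alpha> j - visited_point Z \<alpha> (j - 1))
               \<le> norm (visited_point Z \<alpha> jstar - visited_point Z \<alpha> (jstar - 1))"
  shows "liminf (\<lambda>n. ereal (1 / (real n)\<^sup>2) *
             ln_prob (measure M {\<omega> \<in> space M. has_at_least_type_up_to Z \<epsilon> \<alpha> n (\<lambda>r. \<gamma> r \<omega>)}))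
         \<ge> ereal (- ((norm (visited_point Z \<alpha> jstar - visited_point Z \<alpha> (jstar - 1)))\<^sup>2 / 2))"
proof -
  define D where "D = norm (visited_point Z \<alpha> jstar - visited_point Z \<alpha> (jstar - 1))"
  define p where "p n = measure M {\<omega> \<in> space M. has_at_least_type_up_to Z \<epsilon> \<alpha> n (\<lambda>r. \<gamma> r \<omega>)}" for n
  \<comment> \<open>The normalized logarithm of the \<open>n\<close>-th power of the one-step bound;
    it converges, so its lower limit is its limit.\<close>
  define b where "b n = 1 / (real n)\<^sup>2 * (real n * ln (step_bound DIM('a) \<epsilon> D n))" for n
  have "ereal (- (D\<^sup>2 / 2)) = liminf (\<lambda>n. ereal (b n))"
    using ln_step_bound_limit[OF assms(2), of "DIM('a)" D]
    by (intro lim_imp_Liminf[symmetric]) (simp_all add: b_def)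
  also have "\<dots> \<le> liminf (\<lambda>n. ereal (1 / (real n)\<^sup>2) * ln_prob (p n))"
  proof (rule Liminf_mono)
    show "\<forall>\<^sub>F n in sequentially. ereal (b n) \<le> ereal (1 / (real n)\<^sup>2) * ln_prob (p n)"
      using eventually_gt_at_top[of 0]
    proof eventually_elim
      case (elim n)
      have s: "step_bound DIM('a) \<epsilon> D n > 0" using step_bound_pos[OF assms(2) elim] .
      have ge: "step_bound DIM('a) \<epsilon> D n ^ n \<le> p n"
        unfolding p_def using assms(6)
        by (intro prob_at_least_type_ge[OF assms(1,2) elim]) (simp add: D_def)
      \<comment> \<open>Positivity puts \<open>ln_prob\<close> into its finite branch, so that the
        comparison takes place between real logarithms.\<close>
      have p0: "p n > 0" using less_le_trans[OF zero_less_power[OF s] ge] .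
      have "real n * ln (step_bound DIM('a) \<epsilon> D n) \<le> ln (p n)"
        using ge s p0 by (simp add: ln_realpow[symmetric])
      then have "b n \<le> 1 / (real n)\<^sup>2 * ln (p n)"
        unfolding b_def by (intro mult_left_mono) auto
      then show ?case using p0 by (simp add: ln_prob_def)
    qed
  qed
  finally show ?thesis by (simp add: D_def p_def)
qed

end
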